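(* Let $r\ge 0$ be an integer and $\mu_r\in\mathbb{C}$. The connection coefficients $\lambda^{t}_{n,m}$ defined by $P^{t}_n(\mu_r;r)(x)=\sum_{m=0}^{n}\lambda^{t}_{n,m}P_m(x)$, $n\ge 0$, are given, diagonal by diagonal, as follows. \begin{itemize} \item Diagonal $0$: $\lambda^{t}_{n,n}=1$ for $n\ge 0$. \item Diagonal $2i-1$, for each $1\le i\le r+1$: $\lambda^{t}_{n,n-2i+1}=0$ for $2i-1\le n<r+i$, and $\lambda^{t}_{n,n-2i+1}=-\dfrac{\mu_r}{4^{i-1}}$ for $n\ge r+i$. \item Diagonal $2i$, for each $1\le i\le r$: $\lambda^{t}_{n,n-2i}=0$ for $n\ge 2i$. \item Diagonal $m$, for each $m\ge 2r+2$: $\lambda^{t}_{n,n-m}=0$ for $n\ge m$. \end{itemize}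
   Context: $\{P_n\}_{n\ge0}$ denotes the monic Chebyshev polynomials of the second kind: $P_0=1$, $P_1=x$, $P_{n+2}(x)=xP_{n+1}(x)-\frac14P_n(x)$ for $n\ge 0$. For an integer $r\ge 0$ and $\mu_r\in\mathbb{C}$, the $r$th-perturbed sequence by translation $\{P^t_n(\mu_r;r)\}_{n\ge 0}$ is the monic sequence with $P^t_0=1$, $P^t_1(x)=x-\beta_0$, $P^t_{n+2}(x)=(x-\beta_{n+1})P^t_{n+1}(x)-\frac14P^t_n(x)$ for $n\ge 0$, where $\beta_r=\mu_r$ and $\beta_n=0$ for $n\ne r$. *)

theory Defs
  imports Complex_Main "HOL-Computational_Algebra.Polynomial"
begin

fun cheb_U_monic :: "nat \<Rightarrow> complex poly" where
  "cheb_U_monic 0 = 1"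
| "cheb_U_monic (Suc 0) = [:0, 1:]"
| "cheb_U_monic (Suc (Suc n)) =
     [:0, 1:] * cheb_U_monic (Suc n) - smult (1/4) (cheb_U_monic n)"

definition transl_beta :: "complex \<Rightarrow> nat \<Rightarrow> nat \<Rightarrow> complex" where
  "transl_beta \<mu> r n = (if n = r then \<mu> else 0)"

text \<open>\<open>[:- b, 1:]\<close> is the polynomial \<open>x - b\<close>.\<close>

fun cheb_U_transl :: "complex \<Rightarrow> nat \<Rightarrow> nat \<Rightarrow> complex poly" where
  "cheb_U_transl \<mu> r 0 = 1"
| "cheb_U_transl \<mu> r (Suc 0) = [:- transl_beta \<mu> r 0, 1:]"
| "cheb_U_transl \<mu> r (Suc (Suc n)) =
     [:- transl_beta \<mu> r (Suc n), 1:] * cheb_U_transl \<mu> r (Suc n)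
       - smult (1/4) (cheb_U_transl \<mu> r n)"

text \<open>The values \<open>lam n m\<close> with \<open>m > n\<close> are unconstrained.\<close>

definition connection_coeffs ::
  "(nat \<Rightarrow> complex poly) \<Rightarrow> (nat \<Rightarrow> complex poly) \<Rightarrow> (nat \<Rightarrow> nat \<Rightarrow> complex) \<Rightarrow> bool" where
  "connection_coeffs Q P lam \<longleftrightarrow> (\<forall>n. Q n = (\<Sum>m\<le>n. smult (lam n m) (P m)))"

text \<open>Connection coefficients exist and are unique on \<open>m \<le> n\<close>
  whenever \<open>P\<close> is a monic sequence with \<open>degree (P n) = n\<close>
  and \<open>degree (Q n) \<le> n\<close>; both are shown to hold below.\<close>

lemma monic_seq_expansion_exists:
  assumes P: "\<And>n. degree (P n) = n \<and> lead_coeff (P n) = (1::complex)"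
  shows "degree q \<le> n \<Longrightarrow> \<exists>c. q = (\<Sum>m\<le>n. smult (c m) (P m))"
proof (induction n arbitrary: q)
  case 0
  obtain a where a: "P 0 = [:a:]" using P[of 0] by (auto elim: degree_eq_zeroE)
  obtain b where b: "q = [:b:]" using 0 by (auto elim: degree_eq_zeroE)
  from a P[of 0] have "a = 1" by simp
  with a b show ?case by (intro exI[of _ "\<lambda>_. b"]) simp
next
  case (Suc n)
  have lc: "coeff (P (Suc n)) (Suc n) = 1" using P[of "Suc n"] by auto
  let ?q = "q - smult (coeff q (Suc n)) (P (Suc n))"
  have "degree ?q \<le> n"
  proof (rule degree_le, intro allI impI)
    fix i assume i: "n < i"
    show "coeff ?q i = 0"
    proof (cases "i = Suc n")
      case True
      then show ?thesis using lc by simp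
    next
      case False
      with i have "i > Suc n" by simp
      then show ?thesis using P[of "Suc n"] Suc.prems by (simp add: coeff_eq_0)
    qed
  qed
  then obtain c where c: "?q = (\<Sum>m\<le>n. smult (c m) (P m))" using Suc.IH by blast
  have "q = (\<Sum>m\<le>Suc n. smult ((c(Suc n := coeff q (Suc n))) m) (P m))"
    using c by (simp add: algebra_simps)
  then show ?case by blast
qed

lemma monic_seq_expansion_unique:
  assumes P: "\<And>n. degree (P n) = n \<and> lead_coeff (P n) = (1::complex)"
  shows "(\<Sum>m\<le>n. smult (c m) (P m)) = (\<Sum>m\<le>n. smult (d m) (P m)) \<Longrightarrow> m \<le> n \<Longrightarrow> c m = d m"
proof (induction n arbitrary: m)
  case 0
  obtain a where a: "P 0 = [:a:]" using P[of 0] by (auto elim: degree_eq_zeroE)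
  from a P[of 0] have "a = 1" by simp
  with a 0 show ?case by simp
next
  case (Suc n)
  have lc: "coeff (P (Suc n)) (Suc n) = 1" using P[of "Suc n"] by auto
  have low: "coeff (\<Sum>m\<le>n. smult (e m) (P m)) (Suc n) = 0" for e
    using P by (auto simp: coeff_sum intro!: sum.neutral coeff_eq_0)
  have "c (Suc n) = d (Suc n)"
    using arg_cong[OF Suc.prems(1), of "\<lambda>q. coeff q (Suc n)"] low lc by simp
  with Suc show ?case by (cases "m = Suc n") auto
qed

lemma degree_monic_three_term:
  assumes "degree p = Suc n" "lead_coeff p = (1::complex)" "degree q = n"
  shows "degree ([:b, 1:] * p - smult (1/4) q) = Suc (Suc n)
         \<and> lead_coeff ([:b, 1:] * p - smult (1/4) q) = 1"
proof -
  let ?R = "[:b, 1:] * p - smult (1/4) q"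
  have top: "coeff ?R (Suc (Suc n)) = 1"
    using assms by (simp add: coeff_eq_0)
  have "degree ?R \<le> Suc (Suc n)"
    by (rule degree_le) (use assms in \<open>auto simp: coeff_eq_0 coeff_pCons split: nat.split\<close>)
  then have "degree ?R = Suc (Suc n)"
    using top by (metis le_antisym le_degree zero_neq_one)
  with top show ?thesis by simp
qed

lemma cheb_U_monic_monic:
  "degree (cheb_U_monic n) = n \<and> lead_coeff (cheb_U_monic n) = 1"
proof (induction n rule: cheb_U_monic.induct)
  case (3 n)
  then show ?case unfolding cheb_U_monic.simps by (intro degree_monic_three_term) auto
qed auto

lemma cheb_U_transl_monic:
  "degree (cheb_U_transl \<mu> r n) = n \<and> lead_coeff (cheb_U_transl \<mu> r n) = 1"
proof (induction \<mu> r n rule: cheb_U_transl.induct)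
  case (3 \<mu> r n)
  then show ?case unfolding cheb_U_transl.simps by (intro degree_monic_three_term) auto
qed auto

lemma connection_coeffs_transl_exists:
  "\<exists>lam. connection_coeffs (cheb_U_transl \<mu> r) cheb_U_monic lam"
proof -
  have "\<exists>c. cheb_U_transl \<mu> r n = (\<Sum>m\<le>n. smult (c m) (cheb_U_monic m))" for n
    by (rule monic_seq_expansion_exists[of cheb_U_monic, OF cheb_U_monic_monic])
       (simp add: cheb_U_transl_monic)
  then show ?thesis
    unfolding connection_coeffs_def by (intro choice allI) blast
qed

lemma connection_coeffs_transl_unique:
  assumes "connection_coeffs (cheb_U_transl \<mu> r) cheb_U_monic lam"
    and "connection_coeffs (cheb_U_transl \<mu> r) cheb_U_monic lam'"
    and "m \<le> n"
  shows "lam n m = lam' n m"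
proof -
  have "(\<Sum>m\<le>n. smult (lam n m) (cheb_U_monic m)) = (\<Sum>m\<le>n. smult (lam' n m) (cheb_U_monic m))"
    using assms(1,2)[unfolded connection_coeffs_def, rule_format, of n] by (rule trans[OF sym])
  from monic_seq_expansion_unique[of cheb_U_monic, OF cheb_U_monic_monic this assms(3)]
  show ?thesis .
qed

end

theory Submission
  imports Defs
begin

text \<open>
  Past the perturbed index both sequences satisfy the same recurrence, whence
  \<open>P\<^sup>t\<^sub>n = P\<^sub>n - \<mu> P\<^sub>r P\<^bsub>n-r-1\<^esub>\<close> for \<open>n > r\<close>. The addition formula
  \<open>P\<^bsub>a+1\<^esub> P\<^bsub>b+1\<^esub> = P\<^bsub>a+b+2\<^esub> + P\<^sub>a P\<^sub>b / 4\<close> linearizes the product, and the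
  connection coefficients are read off by uniqueness.
\<close>

lemma cheb_U_monic_add:
  "cheb_U_monic (Suc a) * cheb_U_monic (Suc b) =
     cheb_U_monic (Suc (Suc (a + b))) + smult (1/4) (cheb_U_monic a * cheb_U_monic b)"
proof (induction a arbitrary: b)
  case 0
  then show ?case by simp
next
  case (Suc a)
  let ?U = cheb_U_monic
  \<comment> \<open>One recurrence step moves a unit of index from one factor to the other: with
    \<open>x\<close> denoting \<open>[:0, 1:]\<close>, both sides expand to
    \<open>x * ?U (Suc a) * ?U (Suc b)\<close> minus a quarter of
    \<open>?U a * ?U (Suc b) + ?U (Suc a) * ?U b\<close>.\<close>
  have "?U (Suc (Suc a)) * ?U (Suc b) - smult (1/4) (?U (Suc a) * ?U b) =
        ?U (Suc a) * ?U (Suc (Suc b)) - smult (1/4) (?U a * ?U (Suc b))"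
    by (simp only: cheb_U_monic.simps) (simp add: algebra_simps)
  also have "\<dots> = ?U (Suc (Suc (a + Suc b)))"
    using Suc.IH[of "Suc b"] by simp
  finally show ?case by (simp del: cheb_U_monic.simps add: algebra_simps)
qed

lemma smult_sum_right: "smult c (\<Sum>i\<in>A. f i) = (\<Sum>i\<in>A. smult c (f i))"
  by (induction A rule: infinite_finite_induct) (simp_all add: smult_add_right)

text \<open>Iterating the addition formula lowers both indices until one reaches 0, and each round
  contributes a factor 1/4. The subtraction never truncates, as \<open>j\<close> is at most
  \<open>min a b\<close>.\<close>

lemma cheb_U_monic_mult:
  "cheb_U_monic a * cheb_U_monic b =
     (\<Sum>j\<le>min a b. smult (1 / 4 ^ j) (cheb_U_monic (a + b - 2 * j)))"
proof (induction a arbitrary: b)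
  case 0
  then show ?case by simp
next
  case (Suc a)
  show ?case
  proof (cases b)
    case 0
    then show ?thesis by simp
  next
    case [simp]: (Suc b')
    show ?thesis
      \<comment> \<open>The leading term of the addition formula is the summand
        \<open>j = 0\<close>; the induction hypothesis, scaled by 1/4, supplies the shifted
        rest.\<close>
      by (simp only: Suc cheb_U_monic_add Suc.IH min_Suc_Suc sum.atMost_Suc_shift)
         (simp add: smult_sum_right del: cheb_U_monic.simps)
  qed
qed

lemma cheb_U_transl_below:
  "n \<le> r \<Longrightarrow> cheb_U_transl \<mu> r n = cheb_U_monic n"
  by (induction n rule: cheb_U_monic.induct) (auto simp: transl_beta_def)

text \<open>Both sides obey the unperturbed recurrence in \<open>k\<close>, so agreement at
  \<open>k = 0\<close> and \<open>k = 1\<close> suffices.\<close>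

lemma cheb_U_transl_above:
  "cheb_U_transl \<mu> r (Suc (r + k)) =
     cheb_U_monic (Suc (r + k)) - smult \<mu> (cheb_U_monic r * cheb_U_monic k)"
proof (induction k rule: cheb_U_monic.induct)
  case 1
  show ?case
    \<comment> \<open>The case \<open>r = 0\<close> is separate because degree 1 has its own
      defining equation.\<close>
    by (cases r) (simp_all add: cheb_U_transl_below transl_beta_def)
next
  case 2
  have "cheb_U_transl \<mu> r (Suc r) = cheb_U_monic (Suc r) - smult \<mu> (cheb_U_monic r)"
    by (cases r) (simp_all add: cheb_U_transl_below transl_beta_def)
  then show ?case
    by (simp add: cheb_U_transl_below transl_beta_def algebra_simps)
next
  case (3 k)
  let ?U = cheb_U_monic and ?T = "cheb_U_transl \<mu> r"
  have T: "?T (Suc (r + Suc (Suc k))) = [:0, 1:] * ?T (Suc (r + Suc k)) - smult (1/4) (?T (Suc (r + k)))"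
    by (simp add: transl_beta_def)
  have U: "?U (Suc (r + Suc (Suc k))) = [:0, 1:] * ?U (Suc (r + Suc k)) - smult (1/4) (?U (Suc (r + k)))"
    by simp
  have "?U r * ?U (Suc (Suc k)) = [:0, 1:] * (?U r * ?U (Suc k)) - smult (1/4) (?U r * ?U k)"
    by (simp add: algebra_simps)
  then show ?case
    by (simp only: T U 3) (simp add: smult_diff_right mult.commute del: cheb_U_monic.simps)
qed

text \<open>The condition \<open>r + j < n\<close> makes one formula serve all \<open>n\<close>: it
  leaves no \<open>j\<close> when \<open>n\<close> is at most \<open>r\<close>, and for
  \<open>n = Suc (r + k)\<close> it says that \<open>j\<close> is at most \<open>k\<close>.\<close>

lemma cheb_U_transl_expansion:
  "cheb_U_transl \<mu> r n = cheb_U_monic n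
     - smult \<mu> (\<Sum>j | j \<le> r \<and> r + j < n. smult (1 / 4 ^ j) (cheb_U_monic (n - 1 - 2 * j)))"
proof (cases "n \<le> r")
  case True
  then have "{j. j \<le> r \<and> r + j < n} = {}" by auto
  with True show ?thesis by (simp only: sum.empty) (simp add: cheb_U_transl_below)
next
  case False
  then obtain k where n: "n = Suc (r + k)" by (auto simp: not_le less_iff_Suc_add)
  have "{j. j \<le> r \<and> r + j < n} = {..min r k}" unfolding n by auto
  then show ?thesis
    by (simp only: n cheb_U_transl_above cheb_U_monic_mult) simp
qed

text \<open>Coefficient of \<open>cheb_U_monic m\<close> in the preceding expansion. Summing
  indicators over \<open>j\<close> avoids solving \<open>m = n - 1 - 2 * j\<close> for
  \<open>j\<close>.\<close>

definition transl_coeff :: "complex \<Rightarrow> nat \<Rightarrow> nat \<Rightarrow> nat \<Rightarrow> complex" where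
  "transl_coeff \<mu> r n m = (if m = n then 1 else 0)
     - \<mu> * (\<Sum>j | j \<le> r \<and> r + j < n. if m = n - 1 - 2 * j then 1 / 4 ^ j else 0)"

lemma connection_coeffs_transl_coeff:
  "connection_coeffs (cheb_U_transl \<mu> r) cheb_U_monic (transl_coeff \<mu> r)"
  unfolding connection_coeffs_def
proof
  fix n
  let ?U = cheb_U_monic and ?J = "{j. j \<le> r \<and> r + j < n}"
  let ?c = "\<lambda>m j. if m = n - 1 - 2 * j then 1 / 4 ^ j else (0::complex)"
  have single: "(\<Sum>m\<le>n. smult (if m = k then c else 0) (?U m)) = smult c (?U k)"
    if "k \<le> n" for k and c :: complex
  proof -
    have "(\<Sum>m\<le>n. smult (if m = k then c else 0) (?U m)) =
          (\<Sum>m\<le>n. if m = k then smult c (?U m) else 0)"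
      by (intro sum.cong) auto
    with that show ?thesis by simp
  qed
  have "(\<Sum>m\<le>n. smult (\<Sum>j\<in>?J. ?c m j) (?U m)) = (\<Sum>j\<in>?J. \<Sum>m\<le>n. smult (?c m j) (?U m))"
    by (simp only: smult_sum) (rule sum.swap)
  also have "\<dots> = (\<Sum>j\<in>?J. smult (1 / 4 ^ j) (?U (n - 1 - 2 * j)))"
    by (intro sum.cong refl single) simp
  finally have corr: "(\<Sum>m\<le>n. smult (\<Sum>j\<in>?J. ?c m j) (?U m)) =
      (\<Sum>j\<in>?J. smult (1 / 4 ^ j) (?U (n - 1 - 2 * j)))" .
  have "(\<Sum>m\<le>n. smult (transl_coeff \<mu> r n m) (?U m)) =
        (\<Sum>m\<le>n. smult (if m = n then 1 else 0) (?U m)) -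
        smult \<mu> (\<Sum>m\<le>n. smult (\<Sum>j\<in>?J. ?c m j) (?U m))"
    by (simp only: transl_coeff_def smult_diff_left sum_subtractf smult_sum_right smult_smult)
  also have "\<dots> = cheb_U_transl \<mu> r n"
    by (simp only: single[OF order_refl] corr cheb_U_transl_expansion smult_1_left)
  finally show "cheb_U_transl \<mu> r n = (\<Sum>m\<le>n. smult (transl_coeff \<mu> r n m) (?U m))"
    by (rule sym)
qed

lemma transl_coeff_odd:
  assumes "2 * j + 1 \<le> n"
  shows "transl_coeff \<mu> r n (n - (2 * j + 1)) = (if j \<le> r \<and> r + j < n then - \<mu> / 4 ^ j else 0)"
proof -
  let ?J = "{j. j \<le> r \<and> r + j < n}"
  have fin: "finite ?J" by simp
  \<comment> \<open>On \<open>?J\<close>, \<open>2 * i\<close> is at most \<open>r + i\<close>,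
    which is below \<open>n\<close>; hence no subtraction truncates and equal indices force
    \<open>i = j\<close>.\<close>
  have "(\<Sum>i\<in>?J. if n - (2 * j + 1) = n - 1 - 2 * i then 1 / 4 ^ i else 0) =
        (\<Sum>i\<in>?J. if i = j then 1 / 4 ^ i else (0::complex))"
    using assms by (intro sum.cong) auto
  also have "\<dots> = (if j \<in> ?J then 1 / 4 ^ j else 0)"
    by (simp only: sum.delta[OF fin])
  finally have "(\<Sum>i\<in>?J. if n - (2 * j + 1) = n - 1 - 2 * i then 1 / 4 ^ i else 0) =
    (if j \<in> ?J then 1 / 4 ^ j else (0::complex))" .
  moreover have "n - (2 * j + 1) \<noteq> n" using assms by linarith
  ultimately show ?thesis by (simp only: transl_coeff_def) simp
qed

text \<open>Parity: the correction only meets indices at odd distance from \<open>n\<close>.\<close>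

lemma transl_coeff_even:
  assumes "2 * i \<le> n"
  shows "transl_coeff \<mu> r n (n - 2 * i) = (if i = 0 then 1 else 0)"
proof -
  have "n - 2 * i \<noteq> n - 1 - 2 * j" if "j \<le> r" "r + j < n" for j
  proof
    assume "n - 2 * i = n - 1 - 2 * j"
    with assms that have "2 * i = 2 * j + 1" by linarith
    then show False by presburger
  qed
  then have "(\<Sum>j | j \<le> r \<and> r + j < n. if n - 2 * i = n - 1 - 2 * j then 1 / 4 ^ j else 0) = (0::complex)"
    by (intro sum.neutral) auto
  moreover have "n - 2 * i = n \<longleftrightarrow> i = 0" using assms by linarith
  ultimately show ?thesis by (simp only: transl_coeff_def) simp
qed

theorem theorem3p3:
  fixes r :: nat and \<mu> :: complex and lam :: "nat \<Rightarrow> nat \<Rightarrow> complex"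
  assumes "connection_coeffs (cheb_U_transl \<mu> r) cheb_U_monic lam"
  shows "(\<forall>n. lam n n = 1) \<and>
    (\<forall>i. 1 \<le> i \<and> i \<le> r + 1 \<longrightarrow>
       (\<forall>n. 2 * i - 1 \<le> n \<and> n < r + i \<longrightarrow> lam n (n - (2 * i - 1)) = 0) \<and>
       (\<forall>n. r + i \<le> n \<longrightarrow> lam n (n - (2 * i - 1)) = - \<mu> / 4 ^ (i - 1))) \<and>
    (\<forall>i. 1 \<le> i \<and> i \<le> r \<longrightarrow> (\<forall>n. 2 * i \<le> n \<longrightarrow> lam n (n - 2 * i) = 0)) \<and>
    (\<forall>m. 2 * r + 2 \<le> m \<longrightarrow> (\<forall>n. m \<le> n \<longrightarrow> lam n (n - m) = 0))"
proof -
  have lam: "lam n (n - k) = transl_coeff \<mu> r n (n - k)" for n k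
    using assms connection_coeffs_transl_coeff
    by (rule connection_coeffs_transl_unique) simp
  have diag: "lam n n = 1" for n
    using lam[of n 0] transl_coeff_even[of 0 n \<mu> r] by simp
  have even: "lam n (n - 2 * i) = 0" if "1 \<le> i" "2 * i \<le> n" for i n
    using that by (simp add: lam transl_coeff_even)
  \<comment> \<open>Here \<open>i\<close> is \<open>j + 1\<close> for the summation index
    \<open>j\<close>. Values of \<open>i\<close> beyond \<open>r + 1\<close> are included to cover
    the far diagonals too.\<close>
  have odd: "lam n (n - (2 * i - 1)) = (if i \<le> r + 1 \<and> r + i \<le> n then - \<mu> / 4 ^ (i - 1) else 0)"
    if "1 \<le> i" "2 * i - 1 \<le> n" for i n
  proof -
    from that(1) obtain j where "i = Suc j" by (cases i) auto
    with that(2) show ?thesis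
      using transl_coeff_odd[of j n \<mu> r] by (auto simp: lam)
  qed
  have far: "lam n (n - m) = 0" if "2 * r + 2 \<le> m" "m \<le> n" for m n
  proof (cases "even m")
    case True
    then obtain i where "m = 2 * i" by (elim evenE)
    with that even[of i n] show ?thesis by simp
  next
    case False
    then obtain j where "m = 2 * j + 1" by (elim oddE)
    \<comment> \<open>An odd \<open>m\<close> of at least \<open>2 * r + 2\<close> gives
      \<open>j > r\<close>, hence the zero branch of \<open>odd\<close>.\<close>
    with that odd[of "Suc j" n] show ?thesis by simp
  qed
  \<comment> \<open>For the nonzero range, \<open>odd\<close> applies since \<open>2 * i - 1\<close>
    is at most \<open>r + i\<close> when \<open>i\<close> is at most \<open>r + 1\<close>.\<close>
  show ?thesis using diag even odd far by auto
qed

end
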